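(* Let $j^{\operatorname{last}}_{m,k}(213)$ be the number of $213$-avoiding Jacobi permutations $\pi\in\mathfrak{S}_m$ whose last letter equals $k$. For all $n\geq k\geq1$, \[ j^{\operatorname{last}}_{2n,k}(213)=\frac{2k}{3n-k}\binom{3n-k}{2n}\qquad\text{and}\qquad j^{\operatorname{last}}_{2n-1,k}(213)=\frac{2k-1}{3n-k-1}\binom{3n-k-1}{2n-1}. \]
   Context: A permutation of a finite set $S$ of positive integers is a word in which each element of $S$ appears exactly once; $\mathfrak{S}_m$ is the set of permutations of $\{1,\dots,m\}$. For a permutation $\pi$ and a letter $x$ of $\pi$, $\rho_\pi(x)$ is the maximal consecutive subword of $\pi$ consisting of the letters immediately to the right of $x$ that are all larger than $x$. $\pi$ is Jacobi if $|\rho_\pi(x)|$ is even for all letters $x$. A permutation $\pi$ avoids a pattern $\sigma$ if no subword of $\pi$ has standardization (relative order) $\sigma$. *)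

theory Defs
  imports Complex_Main "HOL-Library.Sublist" "HOL-Combinatorics.Multiset_Permutations"
begin

text \<open>A permutation of a finite set of positive integers is written as a word, i.e. as an
  element of \<^const>\<open>permutations_of_set\<close> of that set.\<close>

definition rho :: "nat list \<Rightarrow> nat \<Rightarrow> nat list" where
  "rho \<pi> x = takeWhile (\<lambda>y. x < y) (tl (dropWhile (\<lambda>y. y \<noteq> x) \<pi>))"

definition jacobi :: "nat list \<Rightarrow> bool" where
  "jacobi \<pi> \<longleftrightarrow> (\<forall>x\<in>set \<pi>. even (length (rho \<pi> x)))"

text \<open>Standardization of a word with distinct letters: the i-th smallest letter is replaced by i.\<close>

definition standardize :: "nat list \<Rightarrow> nat list" where
  "standardize w = map (\<lambda>x. card {y \<in> set w. y \<le> x}) w"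

text \<open>Subwords in pattern containment need not be consecutive.\<close>

definition avoids :: "nat list \<Rightarrow> nat list \<Rightarrow> bool" where
  "avoids \<pi> \<sigma> \<longleftrightarrow> \<not> (\<exists>w. subseq w \<pi> \<and> standardize w = \<sigma>)"

definition j_last :: "nat list \<Rightarrow> nat \<Rightarrow> nat \<Rightarrow> nat" where
  "j_last \<sigma> m k =
     card {\<pi> \<in> permutations_of_set {1..m}. jacobi \<pi> \<and> avoids \<pi> \<sigma> \<and> last \<pi> = k}"

end

theory Submission
  imports Defs "HOL-Computational_Algebra.Formal_Power_Series"
begin

text \<open>
  A word \<open>a # w\<close> with distinct letters avoids 213 and is Jacobi iff \<open>w = U @ V\<close> where all letters of
  \<open>U\<close> exceed \<open>a\<close>, all letters of \<open>V\<close> are below \<open>a\<close>, the length of \<open>U = \<rho>(a)\<close> is even, and \<open>U\<close> and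
  \<open>V\<close> are again Jacobi and 213-avoiding. Let \<open>T\<close> be the generating function of these permutations
  of even length, and \<open>E\<^sub>k\<close>, \<open>D\<^sub>k\<close> those of the permutations of even and odd length with last letter
  \<open>k\<close>; both lengths \<open>2n\<close> and \<open>2n + 1\<close> have weight \<open>X\<^sup>n\<close>. The decomposition gives \<open>T = 1 + X T\<^sup>3\<close>, \<open>E\<^sub>k\<^sub>+\<^sub>1 = X T D\<^sub>k\<^sub>+\<^sub>1\<close> and
  \<open>D\<^sub>k\<^sub>+\<^sub>1 = T E\<^sub>k\<^sub>+\<^sub>1 + E\<^sub>k\<close>, whence \<open>E\<^sub>k = X\<^sup>k T\<^sup>2\<^sup>k\<close> and \<open>D\<^sub>k\<^sub>+\<^sub>1 = T E\<^sub>k\<close>. The coefficients of the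
  powers of \<open>T\<close> are the Fuss--Catalan (Raney) numbers.
\<close>

section \<open>Raney numbers\<close>

text \<open>The case \<open>m = 0\<close> is separate because for \<open>r = 0\<close> the fraction
  would be 0/0, which evaluates to 0, whereas \<open>T ^ 0\<close> has constant term 1.\<close>

definition raney :: "nat \<Rightarrow> nat \<Rightarrow> real" where
  "raney r m = (if m = 0 then 1 else real r / real (3 * m + r) * real ((3 * m + r) choose m))"

text \<open>This is the coefficient form of \<open>T ^ (r + 1) = T ^ r + X * T ^ (r + 3)\<close>.
  All three terms are rational multiples of the single binomial \<open>C\<close>.\<close>

lemma raney_Suc_Suc: "raney (Suc r) (Suc m) = raney r (Suc m) + raney (r + 3) m"
proof -
  define N where "N = 3 * m + r + 3"
  define C where "C = real (N choose m)"
  have Npos: "real N > 0" by (simp add: N_def)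
  have "real (Suc m) * real (Suc N choose Suc m) = real (Suc N) * C"
    unfolding C_def of_nat_mult[symmetric] by (simp only: Suc_times_binomial_eq mult.commute)
  then have c1: "real (Suc N choose Suc m) = real (Suc N) * C / real (Suc m)"
    by (simp add: field_simps)
  have "real (Suc N choose Suc m) = C + real (N choose Suc m)"
    by (simp add: C_def)
  then have c2: "real (N choose Suc m) = (real N - real m) * C / real (Suc m)"
    using c1 by (simp add: field_simps)
  have "raney (Suc r) (Suc m) = real (Suc r) / real (Suc N) * real (Suc N choose Suc m)"
    by (simp add: raney_def N_def add_ac)
  also have "\<dots> = real (Suc r) * C / real (Suc m)"
    unfolding c1 by (simp add: field_simps del: of_nat_Suc)
  finally have l: "raney (Suc r) (Suc m) = real (Suc r) * C / real (Suc m)" .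
  have "raney r (Suc m) = real r / real N * real (N choose Suc m)"
    by (simp add: raney_def N_def add_ac)
  then have r1: "raney r (Suc m) = real r * (real N - real m) * C / (real N * real (Suc m))"
    unfolding c2 by simp
  have r2: "raney (r + 3) m = real (r + 3) * C / real N"
    by (auto simp: raney_def N_def C_def add_ac)
  \<comment> \<open>With the common factor \<open>C\<close> and the denominators cleared, the
    recurrence is this polynomial identity.\<close>
  have "real (Suc r) * real N = real r * (real N - real m) + real (r + 3) * real (Suc m)"
    by (simp add: N_def algebra_simps)
  then have "real (Suc r) * C * real N
      = (real r * (real N - real m) + real (r + 3) * real (Suc m)) * C"
    by (metis mult.commute mult.assoc)
  then have "real (Suc r) * C
      = (real r * (real N - real m) + real (r + 3) * real (Suc m)) * C / real N"
    using Npos by (simp only: eq_divide_eq) simp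
  also have "\<dots> / real (Suc m) = real r * (real N - real m) * C / (real N * real (Suc m))
      + real (r + 3) * C / real N"
    by (simp add: add_divide_distrib distrib_right del: of_nat_Suc)
  finally show ?thesis
    unfolding l r1 r2 .
qed

text \<open>The inner induction on \<open>r\<close> lowers the exponent by one; the other term has
  the larger exponent \<open>r + 3\<close> but index \<open>m\<close>, so the outer induction must
  leave \<open>r\<close> arbitrary.\<close>

lemma fps_nth_power_eq_raney:
  fixes T :: "real fps"
  assumes T: "T = 1 + fps_X * T ^ 3"
  shows "fps_nth (T ^ r) m = raney r m"
proof (induction m arbitrary: r)
  case 0
  have "fps_nth T 0 = 1" by (subst T) simp
  then show ?case by (simp add: fps_power_zeroth raney_def)
next
  case (Suc m)
  show ?case
  proof (induction r)
    case 0
    show ?case by (simp add: raney_def)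
  next
    case (Suc r)
    have "T ^ Suc r = T ^ r * (1 + fps_X * T ^ 3)"
      using T by (metis power_Suc2)
    also have "\<dots> = T ^ r + fps_X * T ^ (r + 3)"
      by (simp add: algebra_simps power_add)
    finally have "fps_nth (T ^ Suc r) (Suc m) = fps_nth (T ^ r) (Suc m) + fps_nth (T ^ (r + 3)) m"
      by simp
    then show ?case
      by (simp only: Suc.IH \<open>\<And>r. fps_nth (T ^ r) m = raney r m\<close> raney_Suc_Suc)
  qed
qed

section \<open>First-letter decomposition\<close>

lemma standardize_eq_213_iff: "standardize [a, b, c] = [2, 1, 3] \<longleftrightarrow> b < a \<and> a < c"
proof
  assume "b < a \<and> a < c"
  then have "{y \<in> {a, b, c}. y \<le> a} = {a, b}" "{y \<in> {a, b, c}. y \<le> b} = {b}"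
    "{y \<in> {a, b, c}. y \<le> c} = {a, b, c}" "a \<noteq> b" "a \<noteq> c" "b \<noteq> c"
    by auto
  then show "standardize [a, b, c] = [2, 1, 3]"
    by (simp add: standardize_def)
next
  assume "standardize [a, b, c] = [2, 1, 3]"
  then have card: "card {y \<in> {a, b, c}. y \<le> a} = 2" "card {y \<in> {a, b, c}. y \<le> b} = 1"
    "card {y \<in> {a, b, c}. y \<le> c} = 3"
    by (simp_all add: standardize_def)
  \<comment> \<open>Used in contraposed form: \<open>a \<le> b\<close> would give 2 \<le> 1 for the
    ranks, and \<open>c \<le> a\<close> would give 3 \<le> 2.\<close>
  have mono: "card {y \<in> {a, b, c}. y \<le> s} \<le> card {y \<in> {a, b, c}. y \<le> t}" if "s \<le> t" for s t
    using that by (intro card_mono) auto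
  show "b < a \<and> a < c"
    using mono[of a b] mono[of c a] card by linarith
qed

definition avoids_213 :: "nat list \<Rightarrow> bool" where
  "avoids_213 \<pi> \<longleftrightarrow> \<not> (\<exists>a b c. subseq [a, b, c] \<pi> \<and> b < a \<and> a < c)"

lemma avoids_213_iff:
  "avoids \<pi> [2, 1, 3] \<longleftrightarrow> avoids_213 \<pi>"
proof -
  have "(\<exists>a b c. w = [a, b, c] \<and> b < a \<and> a < c)" if "standardize w = [2, 1, 3]" for w
  proof -
    have "length w = 3"
      using arg_cong[OF that, of length] by (simp add: standardize_def)
    then obtain a b c where "w = [a, b, c]"
      by (auto simp: numeral_3_eq_3 length_Suc_conv)
    then show ?thesis using that standardize_eq_213_iff by blast
  qed
  then show ?thesis
    unfolding avoids_def avoids_213_def by (metis standardize_eq_213_iff)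
qed

lemma avoids_213_subseq: "avoids_213 \<pi> \<Longrightarrow> subseq \<tau> \<pi> \<Longrightarrow> avoids_213 \<tau>"
  unfolding avoids_213_def using subseq_order.trans by blast

text \<open>An occurrence meeting both parts starts in \<open>U\<close> and ends in
  \<open>V\<close>, so its last letter is below its first, contrary to the pattern.\<close>

lemma avoids_213_append:
  assumes "\<forall>x\<in>set U. \<forall>y\<in>set V. y < x"
  shows "avoids_213 (U @ V) \<longleftrightarrow> avoids_213 U \<and> avoids_213 V"
proof
  assume "avoids_213 (U @ V)"
  then show "avoids_213 U \<and> avoids_213 V"
    by (auto intro: avoids_213_subseq)
next
  assume UV: "avoids_213 U \<and> avoids_213 V"
  have False if sub: "subseq [x, y, z] (U @ V)" and less: "y < x" "x < z" for x y z
  proof -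
    from sub obtain u v where uv: "[x, y, z] = u @ v" "subseq u U" "subseq v V"
      by (elim subseq_appendE)
    have "set u \<subseteq> set U" "set v \<subseteq> set V"
      using uv by (auto dest: list_emb_set)
    moreover have "\<not> subseq [x, y, z] U" "\<not> subseq [x, y, z] V"
      using UV less unfolding avoids_213_def by blast+
    then have "u \<noteq> []" "v \<noteq> []"
      using uv by auto
    then have "hd u = x" "last v = z"
      using uv(1) by (metis hd_append2 list.sel(1), metis last.simps last_append list.distinct(1))
    then have "x \<in> set u" "z \<in> set v"
      using \<open>u \<noteq> []\<close> \<open>v \<noteq> []\<close> by auto
    ultimately show False
      using assms less by (meson less_asym subsetD)
  qed
  then show "avoids_213 (U @ V)"
    unfolding avoids_213_def by blast
qed

lemma avoids_213_Cons:
  "avoids_213 (a # w) \<longleftrightarrow>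
     avoids_213 w \<and> \<not> (\<exists>b c. subseq [b, c] w \<and> b < a \<and> a < c)"
proof -
  have "subseq [x, y, z] (a # w) \<longleftrightarrow> subseq [x, y, z] w \<or> x = a \<and> subseq [y, z] w" for x y z
    using subseq_Cons'[of x "[y, z]" w] by auto
  then show ?thesis
    unfolding avoids_213_def by blast
qed

text \<open>If the maximal prefix of letters above \<open>a\<close> is removed, the rest starts with
  some \<open>b < a\<close>; a later letter \<open>c > a\<close> would complete a forbidden
  pair.\<close>

lemma no_ascent_across_iff:
  fixes a :: nat
  assumes "a \<notin> set w"
  shows "\<not> (\<exists>b c. subseq [b, c] w \<and> b < a \<and> a < c) \<longleftrightarrow>
     (\<exists>U V. w = U @ V \<and> (\<forall>x\<in>set U. a < x) \<and> (\<forall>x\<in>set V. x < a))"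
proof
  assume no: "\<not> (\<exists>b c. subseq [b, c] w \<and> b < a \<and> a < c)"
  define U V where "U = takeWhile (\<lambda>y. a < y) w" and "V = dropWhile (\<lambda>y. a < y) w"
  have w: "w = U @ V" by (simp add: U_def V_def)
  have "x < a" if x: "x \<in> set V" for x
  proof (cases V)
    case Nil
    with x show ?thesis by simp
  next
    case (Cons b V')
    have "\<not> a < b"
      using hd_dropWhile[of "\<lambda>y. a < y" w] Cons unfolding V_def by (metis list.distinct(1) list.sel(1))
    moreover have "b \<noteq> a" "x \<noteq> a"
      using assms x w Cons by auto
    moreover have "subseq [b, x] w" if "x \<noteq> b"
    proof -
      have "subseq [b, x] V"
        using x that Cons by (simp add: subseq_singleton_left)
      then show ?thesis
        using w by (simp add: subseq_drop_many)
    qed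
    ultimately show ?thesis
      using no by (metis nat_neq_iff)
  qed
  moreover have "\<forall>x\<in>set U. a < x"
    by (auto simp: U_def dest: set_takeWhileD)
  ultimately show "\<exists>U V. w = U @ V \<and> (\<forall>x\<in>set U. a < x) \<and> (\<forall>x\<in>set V. x < a)"
    using w by blast
next
  assume "\<exists>U V. w = U @ V \<and> (\<forall>x\<in>set U. a < x) \<and> (\<forall>x\<in>set V. x < a)"
  then obtain U V where w: "w = U @ V" "\<forall>x\<in>set U. a < x" "\<forall>x\<in>set V. x < a"
    by blast
  have False if sub: "subseq [b, c] w" and less: "b < a" "a < c" for b c
  proof -
    from sub obtain u v where uv: "[b, c] = u @ v" "subseq u U" "subseq v V"
      using w(1) by (auto elim: subseq_appendE)
    have "set u \<subseteq> set U" "set v \<subseteq> set V"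
      using uv by (auto dest: list_emb_set)
    \<comment> \<open>Wherever \<open>[b, c]\<close> is cut, \<open>b\<close> lands in
      \<open>U\<close>, contradicting \<open>b < a\<close>, or \<open>c\<close> lands in
      \<open>V\<close>, contradicting \<open>a < c\<close>.\<close>
    moreover have "b \<in> set u \<or> c \<in> set v"
      using uv(1) by (auto simp: Cons_eq_append_conv)
    ultimately show False
      using w less by (meson less_asym subsetD)
  qed
  then show "\<not> (\<exists>b c. subseq [b, c] w \<and> b < a \<and> a < c)"
    by blast
qed

section \<open>The Jacobi condition under concatenation and prefixing\<close>

lemma rho_Cons_same: "rho (a # w) a = takeWhile (\<lambda>y. a < y) w"
  by (simp add: rho_def)

lemma rho_Cons_other: "x \<noteq> a \<Longrightarrow> rho (a # w) x = rho w x"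
  by (simp add: rho_def)

text \<open>The run of letters larger than \<open>x\<close> cannot extend into \<open>V\<close>,
  whose letters are all below \<open>x\<close>.\<close>

lemma rho_append_left:
  assumes "x \<in> set U" and "\<forall>y\<in>set V. y < x"
  shows "rho (U @ V) x = rho U x"
proof -
  have "takeWhile (\<lambda>y. x < y) V = []"
    using assms(2) by (cases V) auto
  then have "takeWhile (\<lambda>y. x < y) (W @ V) = takeWhile (\<lambda>y. x < y) W" for W
    by (induction W) auto
  moreover have "dropWhile (\<lambda>y. y \<noteq> x) U \<noteq> []"
    using assms(1) by (auto simp: dropWhile_eq_Nil_conv)
  moreover have "dropWhile (\<lambda>y. y \<noteq> x) (U @ V) = dropWhile (\<lambda>y. y \<noteq> x) U @ V"
    using assms(1) by (intro dropWhile_append1[of x]) auto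
  ultimately show ?thesis
    unfolding rho_def by (metis tl_append2)
qed

lemma rho_append_right: "x \<notin> set U \<Longrightarrow> rho (U @ V) x = rho V x"
  unfolding rho_def by (subst dropWhile_append2) auto

lemma jacobi_append_iff:
  assumes "\<forall>x\<in>set U. \<forall>y\<in>set V. y < x"
  shows "jacobi (U @ V) \<longleftrightarrow> jacobi U \<and> jacobi V"
proof -
  have "rho (U @ V) x = rho U x" if "x \<in> set U" for x
    using assms that by (simp add: rho_append_left)
  moreover have "rho (U @ V) x = rho V x" if "x \<in> set V" for x
    using assms that by (intro rho_append_right) blast
  ultimately show ?thesis
    unfolding jacobi_def by (metis Un_iff set_append)
qed

lemma jacobi_Cons_iff:
  assumes "a \<notin> set w"
  shows "jacobi (a # w) \<longleftrightarrow> even (length (takeWhile (\<lambda>y. a < y) w)) \<and> jacobi w"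
proof -
  have "rho (a # w) x = rho w x" if "x \<in> set w" for x
    using assms that by (intro rho_Cons_other) blast
  then show ?thesis
    unfolding jacobi_def by (simp add: rho_Cons_same)
qed

definition good :: "nat list \<Rightarrow> bool" where
  "good \<pi> \<longleftrightarrow> jacobi \<pi> \<and> avoids_213 \<pi>"

lemma good_Nil: "good []"
  by (auto simp: good_def jacobi_def avoids_213_def)

lemma good_append_iff:
  "\<forall>x\<in>set U. \<forall>y\<in>set V. y < x \<Longrightarrow> good (U @ V) \<longleftrightarrow> good U \<and> good V"
  by (auto simp: good_def jacobi_append_iff avoids_213_append)

text \<open>Avoidance puts the letters above \<open>a\<close> before those below it. Then
  \<open>U\<close> is the \<open>takeWhile\<close> prefix that computes \<open>rho\<close> at
  \<open>a\<close>, so the Jacobi condition at \<open>a\<close> is the evenness of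
  \<open>length U\<close>.\<close>

lemma good_Cons_iff:
  assumes "a \<notin> set w"
  shows "good (a # w) \<longleftrightarrow> (\<exists>U V. w = U @ V \<and> (\<forall>x\<in>set U. a < x) \<and> (\<forall>x\<in>set V. x < a)
    \<and> even (length U) \<and> good U \<and> good V)"
proof -
  have "even (length (takeWhile (\<lambda>y. a < y) w)) \<and> good w \<longleftrightarrow>
      even (length U) \<and> good U \<and> good V"
    if "w = U @ V" "\<forall>x\<in>set U. a < x" "\<forall>x\<in>set V. x < a" for U V
  proof -
    have "takeWhile (\<lambda>y. a < y) V = []"
      using that by (cases V) auto
    then have "takeWhile (\<lambda>y. a < y) w = U"
      using that by simp
    moreover have "\<forall>x\<in>set U. \<forall>y\<in>set V. y < x"
      using that by (meson less_trans)
    ultimately show ?thesis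
      using that by (simp add: good_append_iff)
  qed
  moreover have "good (a # w) \<longleftrightarrow> even (length (takeWhile (\<lambda>y. a < y) w)) \<and> good w
      \<and> (\<exists>U V. w = U @ V \<and> (\<forall>x\<in>set U. a < x) \<and> (\<forall>x\<in>set V. x < a))"
    unfolding good_def jacobi_Cons_iff[OF assms] avoids_213_Cons no_ascent_across_iff[OF assms]
    by blast
  ultimately show ?thesis
    by blast
qed

section \<open>Recurrences\<close>

text \<open>The shift \<open>c\<close> is needed because the words \<open>U\<close> of the decomposition do not start at letter 1.\<close>

definition good_perms :: "nat \<Rightarrow> nat \<Rightarrow> nat list set" where
  "good_perms c m = {\<pi> \<in> permutations_of_set {c<..c + m}. good \<pi>}"

text \<open>The letter \<open>c\<close> is put in front so that the empty word counts as ending in \<open>c\<close>, i.e. has \<open>k = 0\<close>.\<close>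

definition good_perms_last :: "nat \<Rightarrow> nat \<Rightarrow> nat \<Rightarrow> nat list set" where
  "good_perms_last c m k = {\<pi> \<in> good_perms c m. last (c # \<pi>) = c + k}"

lemma good_perms_iff:
  "\<pi> \<in> good_perms c m \<longleftrightarrow> set \<pi> = {c<..c + m} \<and> distinct \<pi> \<and> good \<pi>"
  by (auto simp: good_perms_def permutations_of_set_def)

lemma finite_good_perms: "finite (good_perms c m)"
  by (simp add: good_perms_def)

lemma finite_good_perms_last: "finite (good_perms_last c m k)"
  by (simp add: good_perms_last_def finite_good_perms)

lemma length_good_perms: "\<pi> \<in> good_perms c m \<Longrightarrow> length \<pi> = m"
  by (auto simp: good_perms_iff dest!: distinct_card)

lemma good_perms_0: "good_perms c 0 = {[]}"
  by (auto simp: good_perms_iff good_Nil)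

lemma good_perms_last_0: "good_perms_last c 0 k = (if k = 0 then {[]} else {})"
  by (auto simp: good_perms_last_def good_perms_0)

text \<open>The first letter is determined by \<open>length U = 2 * j\<close>, the number of letters
  above it. The bound on \<open>j\<close> keeps the subtraction \<open>m - 2 * j\<close> from
  truncating.\<close>

lemma good_perms_Suc_iff:
  "\<pi> \<in> good_perms c (Suc m) \<longleftrightarrow> (\<exists>j\<le>m div 2. \<exists>U V. \<pi> = (c + Suc (m - 2 * j)) # U @ V
     \<and> U \<in> good_perms (c + Suc (m - 2 * j)) (2 * j) \<and> V \<in> good_perms c (m - 2 * j))"
  (is "?l \<longleftrightarrow> ?r")
proof
  assume l: ?l
  then have s: "set \<pi> = {c<..c + Suc m}" and d: "distinct \<pi>" and g: "good \<pi>"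
    by (auto simp: good_perms_iff)
  from s have "\<pi> \<noteq> []" by auto
  then obtain a w where aw: "\<pi> = a # w" by (cases \<pi>) auto
  with d g obtain U V where w: "w = U @ V" and U: "\<forall>x\<in>set U. a < x"
    and V: "\<forall>x\<in>set V. x < a" and e: "even (length U)" and gUV: "good U" "good V"
    using good_Cons_iff[of a w] by auto
  have a: "c < a" "a \<le> c + Suc m"
    using s aw by auto
  have ins: "insert a (set U \<union> set V) = {c<..c + Suc m}"
    using s aw w by simp
  have sU: "set U = {a<..c + Suc m}"
  proof (intro equalityI subsetI)
    fix x assume "x \<in> set U"
    then have "a < x" "x \<in> {c<..c + Suc m}" using U ins by auto
    then show "x \<in> {a<..c + Suc m}" by simp
  next
    fix x assume x: "x \<in> {a<..c + Suc m}"
    then have "x \<in> insert a (set U \<union> set V)" using ins a by auto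
    then show "x \<in> set U" using V x by auto
  qed
  have sV: "set V = {c<..<a}"
  proof (intro equalityI subsetI)
    fix x assume "x \<in> set V"
    then have "x < a" "x \<in> {c<..c + Suc m}" using V ins by auto
    then show "x \<in> {c<..<a}" by simp
  next
    fix x assume x: "x \<in> {c<..<a}"
    then have "x \<in> insert a (set U \<union> set V)" using ins a by auto
    then show "x \<in> set V" using U x by auto
  qed
  have "length U = c + Suc m - a"
    using sU d aw w distinct_card[of U] by simp
  with e obtain j where j: "c + Suc m - a = 2 * j" by (metis evenE)
  then have aj: "a = c + Suc (m - 2 * j)" "2 * j \<le> m"
    using a by auto
  have "U \<in> good_perms a (2 * j)"
    using sU gUV d aw w aj j a by (auto simp: good_perms_iff)
  moreover have "{c<..<a} = {c<..c + (m - 2 * j)}"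
    using aj by auto
  then have "V \<in> good_perms c (m - 2 * j)"
    using sV gUV d aw w by (simp add: good_perms_iff)
  moreover have "j \<le> m div 2" using aj by simp
  ultimately show ?r
    using aw w aj by blast
next
  assume ?r
  then obtain j U V where j: "j \<le> m div 2" and p: "\<pi> = (c + Suc (m - 2 * j)) # U @ V"
    and U: "U \<in> good_perms (c + Suc (m - 2 * j)) (2 * j)" and V: "V \<in> good_perms c (m - 2 * j)"
    by blast
  define a where "a = c + Suc (m - 2 * j)"
  have "2 * j \<le> m" using j by simp
  then have sU: "set U = {a<..c + Suc m}" and sV: "set V = {c<..<a}"
    using U V by (auto simp: good_perms_iff a_def)
  have "a \<notin> set (U @ V)" using sU sV by auto
  moreover have "good (a # U @ V)"
    unfolding good_Cons_iff[OF \<open>a \<notin> set (U @ V)\<close>]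
    using U V sU sV length_good_perms[OF U]
    by (rule_tac exI[of _ U], rule_tac exI[of _ V]) (auto simp: good_perms_iff)
  moreover have "set (a # U @ V) = {c<..c + Suc m}"
    using sU sV by (auto simp: a_def)
  moreover have "distinct (a # U @ V)"
    using U V sU sV by (auto simp: good_perms_iff)
  ultimately show ?l
    using p by (simp add: good_perms_iff a_def)
qed

text \<open>Taking a pair as argument makes the contribution of each \<open>j\<close> the image of a
  Cartesian product.\<close>

definition glue :: "nat \<Rightarrow> nat \<Rightarrow> nat \<Rightarrow> nat list \<times> nat list \<Rightarrow> nat list" where
  "glue c m j = (\<lambda>(U, V). (c + Suc (m - 2 * j)) # U @ V)"

lemma good_perms_Suc:
  "good_perms c (Suc m) = (\<Union>j\<le>m div 2.
     glue c m j ` (good_perms (c + Suc (m - 2 * j)) (2 * j) \<times> good_perms c (m - 2 * j)))"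
  by (rule set_eqI) (simp only: good_perms_Suc_iff UN_iff image_iff Bex_def atMost_iff
      split_paired_Ex mem_Sigma_iff glue_def prod.case, blast)

lemma good_perms_last_Suc_0: "good_perms_last c (Suc m) 0 = {}"
proof -
  have "last \<pi> \<noteq> c" "\<pi> \<noteq> []" if "\<pi> \<in> good_perms c (Suc m)" for \<pi>
  proof -
    from that have s: "set \<pi> = {c<..c + Suc m}" by (simp add: good_perms_iff)
    then show "\<pi> \<noteq> []" by auto
    then show "last \<pi> \<noteq> c" using last_in_set[of \<pi>] s by auto
  qed
  then show ?thesis
    by (auto simp: good_perms_last_def)
qed

text \<open>A nonempty \<open>V\<close> determines the last letter. If \<open>V\<close> is empty,
  then \<open>m = 2 * j\<close> and the first letter is \<open>Suc c\<close>, which is exactly the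
  letter put in front in \<open>good_perms_last (Suc c) m k\<close>; this also covers empty
  \<open>U\<close>.\<close>

lemma good_perms_last_Suc_Suc:
  "good_perms_last c (Suc m) (Suc k) =
     (\<Union>j\<le>m div 2. glue c m j `
        (good_perms (c + Suc (m - 2 * j)) (2 * j) \<times> good_perms_last c (m - 2 * j) (Suc k)))
     \<union> (if even m then Cons (Suc c) ` good_perms_last (Suc c) m k else {})"
  (is "?l = ?A \<union> ?B")
proof (intro equalityI subsetI)
  fix \<pi> assume "\<pi> \<in> ?l"
  then have "\<pi> \<in> good_perms c (Suc m)" and last: "last (c # \<pi>) = c + Suc k"
    by (auto simp: good_perms_last_def)
  then obtain j U V where j: "j \<le> m div 2" and p: "\<pi> = (c + Suc (m - 2 * j)) # U @ V"
    and U: "U \<in> good_perms (c + Suc (m - 2 * j)) (2 * j)" and V: "V \<in> good_perms c (m - 2 * j)"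
    unfolding good_perms_Suc_iff by blast
  show "\<pi> \<in> ?A \<union> ?B"
  proof (cases "V = []")
    case True
    then have m: "m = 2 * j"
      using length_good_perms[OF V] j by simp
    then have "U \<in> good_perms_last (Suc c) m k"
      using U last p True by (simp add: good_perms_last_def)
    then show ?thesis
      using m p True by auto
  next
    case False
    then have "V \<in> good_perms_last c (m - 2 * j) (Suc k)"
      using V last p by (simp add: good_perms_last_def)
    then have "\<pi> \<in> glue c m j `
        (good_perms (c + Suc (m - 2 * j)) (2 * j) \<times> good_perms_last c (m - 2 * j) (Suc k))"
      using U p by (auto simp: glue_def image_iff Bex_def)
    then show ?thesis
      using j by blast
  qed
next
  fix \<pi> assume "\<pi> \<in> ?A \<union> ?B"
  then show "\<pi> \<in> ?l"
  proof
    assume "\<pi> \<in> ?A"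
    then obtain j U V where j: "j \<le> m div 2" and p: "\<pi> = (c + Suc (m - 2 * j)) # U @ V"
      and U: "U \<in> good_perms (c + Suc (m - 2 * j)) (2 * j)"
      and V: "V \<in> good_perms_last c (m - 2 * j) (Suc k)"
      by (auto simp: glue_def)
    from V have V': "V \<in> good_perms c (m - 2 * j)" "last (c # V) = c + Suc k"
      by (auto simp: good_perms_last_def)
    then have "V \<noteq> []" by auto
    then have "last (c # \<pi>) = c + Suc k"
      using V'(2) p by simp
    moreover have "\<pi> \<in> good_perms c (Suc m)"
      unfolding good_perms_Suc_iff using j p U V'(1) by blast
    ultimately show ?thesis
      by (simp add: good_perms_last_def)
  next
    assume B: "\<pi> \<in> ?B"
    then have "even m" by (auto split: if_splits)
    with B obtain U where p: "\<pi> = Suc c # U" and U: "U \<in> good_perms_last (Suc c) m k"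
      by auto
    have "\<pi> = (c + Suc (m - 2 * (m div 2))) # U @ []"
      "U \<in> good_perms (c + Suc (m - 2 * (m div 2))) (2 * (m div 2))"
      "[] \<in> good_perms c (m - 2 * (m div 2))"
      using p U \<open>even m\<close> by (auto simp: good_perms_last_def good_perms_0)
    then have "\<pi> \<in> good_perms c (Suc m)"
      unfolding good_perms_Suc_iff by blast
    then show ?thesis
      using p U by (simp add: good_perms_last_def)
  qed
qed

section \<open>Cardinalities of the decomposed sets\<close>

text \<open>Different \<open>j\<close> give different first letters, so the images are disjoint; for
  fixed \<open>j\<close> the length of \<open>U\<close> locates the cut, so \<open>glue\<close> is
  injective.\<close>

lemma card_UN_glue:
  assumes "\<And>j. j \<le> m div 2 \<Longrightarrow> finite (A j)" and "\<And>j. j \<le> m div 2 \<Longrightarrow> finite (B j)"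
    and "\<And>j U. j \<le> m div 2 \<Longrightarrow> U \<in> A j \<Longrightarrow> length U = 2 * j"
  shows "card (\<Union>j\<le>m div 2. glue c m j ` (A j \<times> B j)) = (\<Sum>j\<le>m div 2. card (A j) * card (B j))"
proof -
  have "card (\<Union>j\<le>m div 2. glue c m j ` (A j \<times> B j))
      = (\<Sum>j\<le>m div 2. card (glue c m j ` (A j \<times> B j)))"
    using assms(1,2) by (intro card_UN_disjoint) (auto simp: glue_def)
  also have "\<dots> = (\<Sum>j\<le>m div 2. card (A j) * card (B j))"
  proof (intro sum.cong refl)
    fix j assume j: "j \<in> {..m div 2}"
    have "inj_on (glue c m j) (A j \<times> B j)"
      using assms(3) j by (intro inj_onI) (auto simp: glue_def append_eq_append_conv)
    then show "card (glue c m j ` (A j \<times> B j)) = card (A j) * card (B j)"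
      by (simp add: card_image card_cartesian_product)
  qed
  finally show ?thesis .
qed

lemma card_good_perms_Suc:
  "card (good_perms c (Suc m)) = (\<Sum>j\<le>m div 2.
     card (good_perms (c + Suc (m - 2 * j)) (2 * j)) * card (good_perms c (m - 2 * j)))"
  unfolding good_perms_Suc
  by (intro card_UN_glue) (auto simp: finite_good_perms length_good_perms)

lemma card_good_perms_last_Suc_Suc:
  "card (good_perms_last c (Suc m) (Suc k)) = (\<Sum>j\<le>m div 2.
     card (good_perms (c + Suc (m - 2 * j)) (2 * j)) * card (good_perms_last c (m - 2 * j) (Suc k)))
     + (if even m then card (good_perms_last (Suc c) m k) else 0)"
proof -
  let ?A = "\<Union>j\<le>m div 2. glue c m j `
    (good_perms (c + Suc (m - 2 * j)) (2 * j) \<times> good_perms_last c (m - 2 * j) (Suc k))"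
  let ?B = "if even m then Cons (Suc c) ` good_perms_last (Suc c) m k else {}"
  \<comment> \<open>A first letter \<open>Suc c\<close> would need \<open>m - 2 * j = 0\<close>, but
    \<open>good_perms_last c 0 (Suc k)\<close> is empty.\<close>
  have "Suc c \<noteq> hd \<pi>" if "\<pi> \<in> ?A" for \<pi>
  proof -
    from that obtain j V where "V \<in> good_perms_last c (m - 2 * j) (Suc k)"
      "hd \<pi> = c + Suc (m - 2 * j)"
      by (auto simp: glue_def)
    then show ?thesis
      by (cases "m - 2 * j") (auto simp: good_perms_last_0)
  qed
  moreover have "Suc c = hd \<pi>" if "\<pi> \<in> ?B" for \<pi>
    using that by (auto split: if_splits)
  ultimately have "?A \<inter> ?B = {}"
    unfolding disjoint_iff by meson
  then have "card (?A \<union> ?B) = card ?A + card ?B"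
    by (intro card_Un_disjoint) (auto simp: finite_good_perms finite_good_perms_last)
  also have "card ?A = (\<Sum>j\<le>m div 2. card (good_perms (c + Suc (m - 2 * j)) (2 * j))
      * card (good_perms_last c (m - 2 * j) (Suc k)))"
    by (intro card_UN_glue) (auto simp: finite_good_perms finite_good_perms_last length_good_perms)
  also have "card ?B = (if even m then card (good_perms_last (Suc c) m k) else 0)"
    by (simp add: card_image)
  finally show ?thesis
    by (simp only: good_perms_last_Suc_Suc)
qed

text \<open>By strong induction the recurrence takes a form free of the shift, so any two shifts
  give the same count.\<close>

lemma card_good_perms_shift: "card (good_perms c m) = card (good_perms 0 m)"
proof (induction m arbitrary: c rule: less_induct)
  case (less m)
  show ?case
  proof (cases m)
    case 0
    then show ?thesis by (simp add: good_perms_0)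
  next
    case (Suc m')
    have "card (good_perms d m)
        = (\<Sum>j\<le>m' div 2. card (good_perms 0 (2 * j)) * card (good_perms 0 (m' - 2 * j)))" for d
      unfolding Suc card_good_perms_Suc
      by (intro sum.cong refl arg_cong2[where f = times] less.IH) (auto simp: Suc)
    from this[of c] this[of 0] show ?thesis
      by (rule trans[OF _ sym])
  qed
qed

lemma card_good_perms_last_shift: "card (good_perms_last c m k) = card (good_perms_last 0 m k)"
proof (induction m arbitrary: c k rule: less_induct)
  case (less m)
  show ?case
  proof (cases m)
    case 0
    then show ?thesis by (simp add: good_perms_last_0)
  next
    case (Suc m')
    show ?thesis
    proof (cases k)
      case 0
      then show ?thesis by (simp add: Suc good_perms_last_Suc_0)
    next
      case (Suc k')
      have "card (good_perms_last d m k)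
          = (\<Sum>j\<le>m' div 2. card (good_perms 0 (2 * j)) * card (good_perms_last 0 (m' - 2 * j) k))
            + (if even m' then card (good_perms_last 0 m' k') else 0)" for d
        unfolding \<open>m = Suc m'\<close> Suc card_good_perms_last_Suc_Suc
        by (intro arg_cong2[where f = plus] sum.cong refl arg_cong2[where f = times] if_cong
            card_good_perms_shift less.IH) (auto simp: \<open>m = Suc m'\<close>)
      from this[of c] this[of 0] show ?thesis
        by (rule trans[OF _ sym])
    qed
  qed
qed

definition num_good :: "nat \<Rightarrow> nat" where
  "num_good m = card (good_perms 0 m)"

definition num_good_last :: "nat \<Rightarrow> nat \<Rightarrow> nat" where
  "num_good_last m k = card (good_perms_last 0 m k)"

lemma num_good_0: "num_good 0 = 1"
  by (simp add: num_good_def good_perms_0)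

lemma num_good_Suc: "num_good (Suc m) = (\<Sum>j\<le>m div 2. num_good (2 * j) * num_good (m - 2 * j))"
  unfolding num_good_def card_good_perms_Suc
  by (intro sum.cong refl arg_cong2[where f = times] card_good_perms_shift)

lemma num_good_last_0: "num_good_last 0 k = (if k = 0 then 1 else 0)"
  by (simp add: num_good_last_def good_perms_last_0)

lemma num_good_last_Suc_0: "num_good_last (Suc m) 0 = 0"
  by (simp add: num_good_last_def good_perms_last_Suc_0)

lemma num_good_last_Suc_Suc:
  "num_good_last (Suc m) (Suc k) =
     (\<Sum>j\<le>m div 2. num_good (2 * j) * num_good_last (m - 2 * j) (Suc k))
     + (if even m then num_good_last m k else 0)"
  unfolding num_good_last_def num_good_def card_good_perms_last_Suc_Suc
  by (intro arg_cong2[where f = plus] sum.cong refl arg_cong2[where f = times]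
      card_good_perms_shift if_cong card_good_perms_last_shift)

text \<open>For nonempty words the letter 0 put in front does not affect \<open>last\<close>;
  positivity of \<open>m\<close> excludes the empty word.\<close>

lemma j_last_eq_num_good_last:
  assumes "m > 0"
  shows "j_last [2, 1, 3] m k = num_good_last m k"
proof -
  have "\<pi> \<noteq> []" if "\<pi> \<in> permutations_of_set {1..m}" for \<pi>
    using assms that by (auto simp: permutations_of_set_def)
  moreover have "{0<..0 + m} = {1..m}" by auto
  ultimately have "{\<pi> \<in> permutations_of_set {1..m}. jacobi \<pi> \<and> avoids \<pi> [2, 1, 3] \<and> last \<pi> = k}
      = good_perms_last 0 m k"
    unfolding good_perms_last_def good_perms_def good_def avoids_213_iff by auto
  then show ?thesis
    by (simp add: j_last_def num_good_last_def)
qed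

section \<open>Generating functions\<close>

definition even_fps :: "real fps" where
  "even_fps = Abs_fps (\<lambda>n. real (num_good (2 * n)))"

definition even_last_fps :: "nat \<Rightarrow> real fps" where
  "even_last_fps k = Abs_fps (\<lambda>n. real (num_good_last (2 * n) k))"

definition odd_last_fps :: "nat \<Rightarrow> real fps" where
  "odd_last_fps k = Abs_fps (\<lambda>n. real (num_good_last (Suc (2 * n)) k))"

text \<open>For odd total length \<open>V\<close> has even length, giving \<open>D = T * T\<close>;
  for even positive length \<open>V\<close> has odd length, giving
  \<open>T = 1 + X * T * D\<close>.\<close>

lemma even_fps_eq: "even_fps = 1 + fps_X * even_fps ^ 3"
proof -
  define D where "D = Abs_fps (\<lambda>n. real (num_good (Suc (2 * n))))"
  have "D = even_fps * even_fps"
    by (intro fps_ext)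
      (simp add: D_def even_fps_def fps_mult_nth num_good_Suc atLeast0AtMost diff_mult_distrib2)
  moreover have "even_fps = 1 + fps_X * (even_fps * D)"
  proof (intro fps_ext)
    fix n
    show "fps_nth even_fps n = fps_nth (1 + fps_X * (even_fps * D)) n"
    proof (cases n)
      case 0
      then show ?thesis by (simp add: even_fps_def num_good_0)
    next
      case (Suc i)
      have "Suc (2 * i) - 2 * j = Suc (2 * (i - j))" if "j \<le> i" for j
        using that by simp
      then have "num_good (2 * n) = (\<Sum>j\<le>i. num_good (2 * j) * num_good (Suc (2 * (i - j))))"
        using num_good_Suc[of "Suc (2 * i)"] by (simp add: Suc)
      then have "fps_nth even_fps n = fps_nth (even_fps * D) i"
        by (simp add: D_def even_fps_def fps_mult_nth atLeast0AtMost)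
      then show ?thesis
        by (simp add: Suc)
    qed
  qed
  ultimately show ?thesis
    by (simp add: power3_eq_cube mult.assoc)
qed

lemma even_last_fps_0: "even_last_fps 0 = 1"
proof (intro fps_ext)
  fix n show "fps_nth (even_last_fps 0) n = fps_nth 1 n"
    by (cases n) (simp_all add: even_last_fps_def num_good_last_0 num_good_last_Suc_0)
qed

lemma odd_last_fps_Suc:
  "odd_last_fps (Suc k) = even_fps * even_last_fps (Suc k) + even_last_fps k"
  by (intro fps_ext)
    (simp add: odd_last_fps_def even_fps_def even_last_fps_def fps_mult_nth num_good_last_Suc_Suc
      atLeast0AtMost diff_mult_distrib2)

text \<open>An odd number of letters follows the first one and \<open>U\<close> has even length, so
  \<open>V\<close> has odd length and the term for empty \<open>V\<close> is absent.\<close>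

lemma even_last_fps_Suc: "even_last_fps (Suc k) = fps_X * (even_fps * odd_last_fps (Suc k))"
proof (intro fps_ext)
  fix n
  show "fps_nth (even_last_fps (Suc k)) n = fps_nth (fps_X * (even_fps * odd_last_fps (Suc k))) n"
  proof (cases n)
    case 0
    then show ?thesis by (simp add: even_last_fps_def num_good_last_0)
  next
    case (Suc i)
    have "Suc (2 * i) - 2 * j = Suc (2 * (i - j))" if "j \<le> i" for j
      using that by simp
    then have "num_good_last (2 * n) (Suc k)
        = (\<Sum>j\<le>i. num_good (2 * j) * num_good_last (Suc (2 * (i - j))) (Suc k))"
      using num_good_last_Suc_Suc[of "Suc (2 * i)" k] by (simp add: Suc)
    then have "fps_nth (even_last_fps (Suc k)) n = fps_nth (even_fps * odd_last_fps (Suc k)) i"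
      by (simp add: even_last_fps_def odd_last_fps_def even_fps_def fps_mult_nth atLeast0AtMost)
    then show ?thesis
      by (simp add: Suc)
  qed
qed

text \<open>The two recurrences give \<open>D = X * T ^ 2 * D + E\<close>. Since
  \<open>T * (1 - X * T ^ 2) = 1\<close>, multiplication by \<open>T\<close> solves for
  \<open>D\<close> without dividing series.\<close>

lemma odd_last_fps_Suc_eq: "odd_last_fps (Suc k) = even_fps * even_last_fps k"
proof -
  define T where "T = even_fps"
  define D where "D = odd_last_fps (Suc k)"
  define E where "E = even_last_fps k"
  have T: "T = 1 + fps_X * T ^ 3"
    unfolding T_def by (rule even_fps_eq)
  have D: "D = fps_X * T ^ 2 * D + E"
    unfolding D_def E_def T_def
    by (subst odd_last_fps_Suc, subst even_last_fps_Suc) (simp add: power2_eq_square mult_ac)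
  then have "T * D = fps_X * T ^ 3 * D + T * E"
    by (metis (no_types, lifting) distrib_left mult.assoc mult.left_commute power2_eq_square
        power3_eq_cube)
  moreover have "T * D = D + fps_X * T ^ 3 * D"
    by (subst (1) T) (simp add: distrib_right)
  ultimately show ?thesis
    by (simp add: T_def D_def E_def)
qed

lemma even_last_fps_eq: "even_last_fps k = fps_X ^ k * even_fps ^ (2 * k)"
proof (induction k)
  case 0
  then show ?case by (simp add: even_last_fps_0)
next
  case (Suc k)
  then show ?case
    by (simp add: even_last_fps_Suc odd_last_fps_Suc_eq mult_ac)
qed

section \<open>Extraction of coefficients and the closed formulas\<close>

lemma num_good_last_even:
  assumes "k \<le> n"
  shows "real (num_good_last (2 * n) k) = raney (2 * k) (n - k)"
proof -
  have "real (num_good_last (2 * n) k) = fps_nth (fps_X ^ k * even_fps ^ (2 * k)) n"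
    by (simp flip: even_last_fps_eq add: even_last_fps_def)
  also have "\<dots> = raney (2 * k) (n - k)"
    using assms by (simp add: fps_X_power_mult_nth fps_nth_power_eq_raney[OF even_fps_eq])
  finally show ?thesis .
qed

lemma num_good_last_odd:
  assumes "k \<le> n"
  shows "real (num_good_last (Suc (2 * n)) (Suc k)) = raney (Suc (2 * k)) (n - k)"
proof -
  have "odd_last_fps (Suc k) = fps_X ^ k * even_fps ^ Suc (2 * k)"
    by (simp add: odd_last_fps_Suc_eq even_last_fps_eq mult_ac)
  then have "real (num_good_last (Suc (2 * n)) (Suc k))
      = fps_nth (fps_X ^ k * even_fps ^ Suc (2 * k)) n"
    by (metis fps_nth_Abs_fps odd_last_fps_def)
  also have "\<dots> = raney (Suc (2 * k)) (n - k)"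
    using assms by (simp add: fps_X_power_mult_nth fps_nth_power_eq_raney[OF even_fps_eq]
        del: power_Suc)
  finally show ?thesis .
qed

text \<open>Passes to the complementary lower index of the binomial; \<open>r > 0\<close> makes the
  formula yield 1 at \<open>m = 0\<close> as well.\<close>

lemma raney_eq:
  assumes "r > 0"
  shows "raney r m = real r / real (3 * m + r) * real ((3 * m + r) choose (2 * m + r))"
  using assms binomial_symmetric[of m "3 * m + r"] by (auto simp: raney_def)

theorem theorem4p7:
  fixes n k :: nat
  assumes "n \<ge> k" and "k \<ge> 1"
  shows "real (j_last [2, 1, 3] (2 * n) k)
           = (2 * real k) / (3 * real n - real k) * real ((3 * n - k) choose (2 * n))
       \<and> real (j_last [2, 1, 3] (2 * n - 1) k)
           = (2 * real k - 1) / (3 * real n - real k - 1) * real ((3 * n - k - 1) choose (2 * n - 1))"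
proof
  obtain d where n: "n = k + d"
    using assms(1) le_Suc_ex by blast
  obtain l where k: "k = Suc l"
    using assms(2) by (cases k) auto
  have "real (j_last [2, 1, 3] (2 * n) k) = raney (2 * k) d"
    using assms num_good_last_even[of k n] j_last_eq_num_good_last[of "2 * n" k] by (simp add: n)
  moreover have "3 * d + 2 * k = 3 * n - k" "2 * d + 2 * k = 2 * n"
    by (simp_all add: n)
  moreover have "real (3 * n - k) = 3 * real n - real k"
    by (simp add: n)
  ultimately show "real (j_last [2, 1, 3] (2 * n) k)
      = (2 * real k) / (3 * real n - real k) * real ((3 * n - k) choose (2 * n))"
    using assms raney_eq[of "2 * k" d] by simp
  \<comment> \<open>The odd case is indexed by \<open>n - 1 = l + d\<close> and
    \<open>k - 1 = l\<close>, so the Raney index is again \<open>d\<close>.\<close>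
  have "2 * n - 1 = Suc (2 * (l + d))"
    by (simp add: n k)
  then have "real (j_last [2, 1, 3] (2 * n - 1) k) = raney (Suc (2 * l)) d"
    using num_good_last_odd[of l "l + d"] j_last_eq_num_good_last[of "2 * n - 1" k]
    by (simp add: k)
  moreover have "3 * d + Suc (2 * l) = 3 * n - k - 1" "2 * d + Suc (2 * l) = 2 * n - 1"
    by (simp_all add: n k)
  moreover have "real (3 * n - k - 1) = 3 * real n - real k - 1" "real (Suc (2 * l)) = 2 * real k - 1"
    by (simp_all add: n k)
  ultimately show "real (j_last [2, 1, 3] (2 * n - 1) k)
      = (2 * real k - 1) / (3 * real n - real k - 1) * real ((3 * n - k - 1) choose (2 * n - 1))"
    using raney_eq[OF zero_less_Suc, of "2 * l" d] by (simp only:)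
qed

end
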